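(* Let $X$ be a real Archimedean vector lattice that is not universally complete, and let $X^u$ be its universal completion, with $X$ regarded as a sublattice of $X^u$. Then there exists a $uo$-Cauchy net in $X$ that fails to be $o$-convergent in $X^u$ (i.e. does not $o$-converge in $X^u$ to any element of $X^u$).
   Context: All vector lattices are real and Archimedean. Nets are indexed by arbitrary (nonempty) directed sets. Universal completion: a vector lattice is Dedekind complete if every nonempty order bounded subset has a supremum (and an infimum). A Dedekind complete vector lattice $Z$ is universally complete if every pairwise disjoint subset of $Z_+$ has a supremum in $Z$. A sublattice $Y$ of a vector lattice $Z$ is order dense if for every $0\neq z\in Z_+$ there is $0\neq y\in Y_+$ with $y\le z$. The universal completion $X^u$ of $X$ is the (unique up to lattice isomorphism) universally complete vector lattice containing $X$ as an order dense sublattice. Order convergence: a net $(x_\alpha)_{\alpha\in A}$ in a vector lattice $Z$ $o$-converges to $x\in Z$ (in $Z$) if there is a net $(y_\gamma)_{\gamma\in\Gamma}$ in $Z$ (possibly over a different index set) with $y_\gamma\downarrow 0$ (i.e. decreasing with infimum $0$ in $Z$) such that for every $\gamma\in\Gamma$ there is $\alpha_\gamma\in A$ with $|x_\alpha-x|\le y_\gamma$ for all $\alpha\ge\alpha_\gamma$. Unbounded order convergence: a net $(x_\alpha)$ in $Z$ $uo$-converges to $x\in Z$ (in $Z$) if $|x_\alpha-x|\wedge y$ $o$-converges to $0$ in $Z$ for every $y\in Z_+$. $uo$-Cauchy: a net $(x_\alpha)_{\alpha\in A}$ in $X$ is $uo$-Cauchy if the double net $(x_\alpha-x_\beta)_{(\alpha,\beta)\in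 A\times A}$, indexed by $A\times A$ with the coordinatewise order, $uo$-converges to $0$ in $X$. *)

theory Defs
  imports "HOL-Analysis.Analysis" "HOL-Library.Lattice_Algebras" "HOL-Library.Lub_Glb"
begin

class vector_lattice = ordered_real_vector + lattice_ab_group_add_abs

class archimedean_vector_lattice = vector_lattice +
  assumes archimedean: "0 \<le> x \<Longrightarrow> (\<And>n::nat. real n *\<^sub>R x \<le> y) \<Longrightarrow> x = 0"

definition dedekind_complete :: "'a::vector_lattice itself \<Rightarrow> bool" where
  "dedekind_complete _ \<longleftrightarrow>
     (\<forall>S::'a set. S \<noteq> {} \<and> (\<exists>l u. S \<subseteq> {l..u}) \<longrightarrow>
        (\<exists>s. isLub UNIV S s) \<and> (\<exists>t. isGlb UNIV S t))"

text \<open>The disjoint set has to be nonempty: a least upper bound of the empty set would be a least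
  element, which only the zero space has.\<close>
definition universally_complete :: "'a::vector_lattice itself \<Rightarrow> bool" where
  "universally_complete T \<longleftrightarrow> dedekind_complete T \<and>
     (\<forall>S::'a set. S \<noteq> {} \<and> S \<subseteq> {0..} \<and> pairwise (\<lambda>x y. inf x y = 0) S \<longrightarrow>
        (\<exists>s. isLub UNIV S s))"

definition order_dense :: "'a::vector_lattice set \<Rightarrow> bool" where
  "order_dense Y \<longleftrightarrow> (\<forall>z. 0 \<le> z \<and> z \<noteq> 0 \<longrightarrow> (\<exists>y\<in>Y. 0 \<le> y \<and> y \<noteq> 0 \<and> y \<le> z))"

definition lattice_embedding :: "('a::vector_lattice \<Rightarrow> 'b::vector_lattice) \<Rightarrow> bool" where
  "lattice_embedding i \<longleftrightarrow> linear i \<and> inj i \<and>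
     (\<forall>x y. i (sup x y) = sup (i x) (i y) \<and> i (inf x y) = inf (i x) (i y))"

text \<open>The type \<open>'b\<close> is the universal completion of the type \<open>'a\<close>, which is identified with the
  sublattice \<open>range i\<close> of \<open>'b\<close>.\<close>
definition is_universal_completion :: "('a::vector_lattice \<Rightarrow> 'b::vector_lattice) \<Rightarrow> bool" where
  "is_universal_completion i \<longleftrightarrow>
     universally_complete TYPE('b) \<and> lattice_embedding i \<and> order_dense (range i)"

text \<open>A pair \<open>(a, b) \<in> r\<close> means that \<open>a\<close> precedes \<open>b\<close>. A net in \<open>'z\<close> is a triple \<open>A\<close>, \<open>r\<close>, \<open>x\<close>
  with \<open>directed_set A r\<close> and \<open>x :: 'i \<Rightarrow> 'z\<close>; only the values of \<open>x\<close> on \<open>A\<close> matter.\<close>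
definition directed_set :: "'i set \<Rightarrow> 'i rel \<Rightarrow> bool" where
  "directed_set A r \<longleftrightarrow> A \<noteq> {} \<and> preorder_on A r \<and>
     (\<forall>a\<in>A. \<forall>b\<in>A. \<exists>c\<in>A. (a, c) \<in> r \<and> (b, c) \<in> r)"

definition decreases_to_0 :: "'g set \<Rightarrow> 'g rel \<Rightarrow> ('g \<Rightarrow> 'z::vector_lattice) \<Rightarrow> bool" where
  "decreases_to_0 G s y \<longleftrightarrow>
     (\<forall>(g, h)\<in>s. y h \<le> y g) \<and> isGlb UNIV (y ` G) 0"

text \<open>The dominating net is indexed by a directed set in the type \<open>'z\<close> itself. This is no
  restriction, by lemma \<open>o_convergentI\<close> below.\<close>
definition o_convergent_to :: "'i set \<Rightarrow> 'i rel \<Rightarrow> ('i \<Rightarrow> 'z::vector_lattice) \<Rightarrow> 'z \<Rightarrow> bool" where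
  "o_convergent_to A r x l \<longleftrightarrow>
     (\<exists>(G::'z set) s y. directed_set G s \<and> decreases_to_0 G s y \<and>
        (\<forall>g\<in>G. \<exists>a\<in>A. \<forall>b\<in>A. (a, b) \<in> r \<longrightarrow> \<bar>x b - l\<bar> \<le> y g))"

definition uo_convergent_to :: "'i set \<Rightarrow> 'i rel \<Rightarrow> ('i \<Rightarrow> 'z::vector_lattice) \<Rightarrow> 'z \<Rightarrow> bool" where
  "uo_convergent_to A r x l \<longleftrightarrow>
     (\<forall>y\<ge>0. o_convergent_to A r (\<lambda>a. inf \<bar>x a - l\<bar> y) 0)"

definition product_order :: "'i rel \<Rightarrow> ('i \<times> 'i) rel" where
  "product_order r = {((a, b), (c, d)). (a, c) \<in> r \<and> (b, d) \<in> r}"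

definition uo_Cauchy :: "'i set \<Rightarrow> 'i rel \<Rightarrow> ('i \<Rightarrow> 'z::vector_lattice) \<Rightarrow> bool" where
  "uo_Cauchy A r x \<longleftrightarrow> uo_convergent_to (A \<times> A) (product_order r) (\<lambda>(a, b). x a - x b) 0"

lemma o_convergentI:
  fixes x :: "'i \<Rightarrow> 'z::vector_lattice" and G :: "'g set" and y :: "'g \<Rightarrow> 'z"
  assumes G: "directed_set G s" and y: "decreases_to_0 G s y"
    and dom: "\<forall>g\<in>G. \<exists>a\<in>A. \<forall>b\<in>A. (a, b) \<in> r \<longrightarrow> \<bar>x b - l\<bar> \<le> y g"
  shows "o_convergent_to A r x l"
proof -
  define H where "H = y ` G"
  define t where "t = {(u, v). u \<in> H \<and> v \<in> H \<and> v \<le> u}"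
  have "\<exists>c\<in>H. (a, c) \<in> t \<and> (b, c) \<in> t" if ab: "a \<in> H" "b \<in> H" for a b
  proof -
    from ab obtain g h where g: "g \<in> G" "a = y g" and h: "h \<in> G" "b = y h"
      unfolding H_def by blast
    with G obtain k where "k \<in> G" "(g, k) \<in> s" "(h, k) \<in> s"
      unfolding directed_set_def by meson
    then show ?thesis
      using y g h unfolding decreases_to_0_def t_def H_def by blast
  qed
  moreover have "preorder_on H t"
    unfolding preorder_on_def refl_on_def trans_def t_def by (auto intro: order_trans)
  ultimately have "directed_set H t"
    using G unfolding directed_set_def H_def by blast
  moreover have "decreases_to_0 H t (\<lambda>v. v)"
    using y unfolding decreases_to_0_def t_def H_def by auto
  ultimately show ?thesis
    using dom unfolding o_convergent_to_def H_def by blast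
qed

lemma o_convergent_to_transfer:
  fixes x :: "'i \<Rightarrow> 'z::vector_lattice" and y :: "'j \<Rightarrow> 'z"
  assumes x: "o_convergent_to A r x l"
    and tails: "\<And>a. a \<in> A \<Longrightarrow>
      \<exists>b\<in>B. \<forall>b'\<in>B. (b, b') \<in> s \<longrightarrow> (\<exists>a'\<in>A. (a, a') \<in> r \<and> y b' = x a')"
  shows "o_convergent_to B s y l"
proof -
  obtain G :: "'z set" and t z where z: "directed_set G t" "decreases_to_0 G t z"
    and dom: "\<And>g. g \<in> G \<Longrightarrow> \<exists>a\<in>A. \<forall>a'\<in>A. (a, a') \<in> r \<longrightarrow> \<bar>x a' - l\<bar> \<le> z g"
    using x unfolding o_convergent_to_def by blast
  show ?thesis
  proof (rule o_convergentI[OF z], intro ballI)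
    fix g assume "g \<in> G"
    then obtain a where a: "a \<in> A" "\<forall>a'\<in>A. (a, a') \<in> r \<longrightarrow> \<bar>x a' - l\<bar> \<le> z g"
      using dom by blast
    from tails[OF a(1)] a(2)
    show "\<exists>b\<in>B. \<forall>b'\<in>B. (b, b') \<in> s \<longrightarrow> \<bar>y b' - l\<bar> \<le> z g" by metis
  qed
qed

text \<open>Every net in \<open>'a\<close> can be reindexed by the pairs of one of its tails and an element of that
  tail. Hence asking for a net indexed by a directed set in \<open>'a set \<times> 'a\<close> is the same as asking
  for a net indexed by an arbitrary directed set.\<close>
lemma net_index_type:
  fixes A :: "'i set" and x :: "'i \<Rightarrow> 'a::vector_lattice" and i :: "'a \<Rightarrow> 'b::vector_lattice"
  assumes A: "directed_set A r" and cauchy: "uo_Cauchy A r x"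
    and div: "\<nexists>l. o_convergent_to A r (\<lambda>a. i (x a)) l"
  shows "\<exists>(B::('a set \<times> 'a) set) s y. directed_set B s \<and> uo_Cauchy B s y \<and>
    (\<nexists>l. o_convergent_to B s (\<lambda>b. i (y b)) l)"
proof -
  define T where "T a = x ` {a'\<in>A. (a, a') \<in> r}" for a
  define B where "B = {(S, v). v \<in> S \<and> S \<in> T ` A}"
  define s where "s = {(p, q). p \<in> B \<and> q \<in> B \<and> fst q \<subseteq> fst p}"
  have refl: "(a, a) \<in> r" if "a \<in> A" for a
    using A that unfolding directed_set_def preorder_on_def refl_on_def by blast
  have trans: "(a, c) \<in> r" if "(a, b) \<in> r" "(b, c) \<in> r" for a b c
    using A that unfolding directed_set_def preorder_on_def trans_def by blast
  have T_mono: "T b \<subseteq> T a" if "(a, b) \<in> r" for a b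
    using that trans unfolding T_def by blast
  have TB: "(T a, x a') \<in> B" if "a \<in> A" "a' \<in> A" "(a, a') \<in> r" for a a'
    using that unfolding B_def T_def by auto
  have to_B: "\<exists>b\<in>B. \<forall>b'\<in>B. (b, b') \<in> s \<longrightarrow> (\<exists>a'\<in>A. (a, a') \<in> r \<and> snd b' = x a')"
    if a: "a \<in> A" for a
  proof (intro bexI[of _ "(T a, x a)"] ballI impI)
    show "(T a, x a) \<in> B" using TB[OF a a refl[OF a]] .
    fix b' assume "b' \<in> B" "((T a, x a), b') \<in> s"
    then have "snd b' \<in> T a" unfolding s_def B_def by auto
    then show "\<exists>a'\<in>A. (a, a') \<in> r \<and> snd b' = x a'" unfolding T_def by blast
  qed
  have of_B: "\<exists>a\<in>A. \<forall>a'\<in>A. (a, a') \<in> r \<longrightarrow> (\<exists>b'\<in>B. (b, b') \<in> s \<and> x a' = snd b')"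
    if b: "b \<in> B" for b
  proof -
    obtain a where a: "a \<in> A" "fst b = T a" using b unfolding B_def by auto
    have "(b, (T a, x a')) \<in> s" if "a' \<in> A" "(a, a') \<in> r" for a'
      using that a b TB unfolding s_def by simp
    then show ?thesis using a(1) TB by (metis snd_conv)
  qed
  have "directed_set B s"
    unfolding directed_set_def
  proof (intro conjI ballI)
    show "B \<noteq> {}" using A to_B unfolding directed_set_def by blast
    show "preorder_on B s"
      unfolding preorder_on_def refl_on_def trans_def s_def by auto
    fix p q assume pq: "p \<in> B" "q \<in> B"
    then obtain a b where ab: "a \<in> A" "fst p = T a" "b \<in> A" "fst q = T b"
      unfolding B_def by auto
    then obtain c where c: "c \<in> A" "(a, c) \<in> r" "(b, c) \<in> r"
      using A unfolding directed_set_def by meson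
    have "(T c, x c) \<in> B" using TB[OF c(1) c(1) refl[OF c(1)]] .
    then show "\<exists>c\<in>B. (p, c) \<in> s \<and> (q, c) \<in> s"
      using T_mono[OF c(2)] T_mono[OF c(3)] pq ab unfolding s_def
      by (intro bexI[of _ "(T c, x c)"]) auto
  qed
  moreover have "uo_Cauchy B s snd"
    unfolding uo_Cauchy_def uo_convergent_to_def
  proof (intro allI impI)
    fix w :: 'a assume "0 \<le> w"
    then have conv: "o_convergent_to (A \<times> A) (product_order r)
        (\<lambda>p. inf \<bar>(case p of (a, b) \<Rightarrow> x a - x b) - 0\<bar> w) 0"
      using cauchy unfolding uo_Cauchy_def uo_convergent_to_def by blast
    show "o_convergent_to (B \<times> B) (product_order s)
        (\<lambda>p. inf \<bar>(case p of (a, b) \<Rightarrow> snd a - snd b) - 0\<bar> w) 0"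
    proof (rule o_convergent_to_transfer[OF conv])
      fix p assume "p \<in> A \<times> A"
      then obtain a1 a2 where p: "p = (a1, a2)" "a1 \<in> A" "a2 \<in> A" by blast
      obtain b1 where b1: "b1 \<in> B"
        "\<And>b'. b' \<in> B \<Longrightarrow> (b1, b') \<in> s \<Longrightarrow> \<exists>a'\<in>A. (a1, a') \<in> r \<and> snd b' = x a'"
        using to_B[OF p(2)] by blast
      obtain b2 where b2: "b2 \<in> B"
        "\<And>b'. b' \<in> B \<Longrightarrow> (b2, b') \<in> s \<Longrightarrow> \<exists>a'\<in>A. (a2, a') \<in> r \<and> snd b' = x a'"
        using to_B[OF p(3)] by blast
      show "\<exists>b\<in>B \<times> B. \<forall>b'\<in>B \<times> B. (b, b') \<in> product_order s \<longrightarrow>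
          (\<exists>a'\<in>A \<times> A. (p, a') \<in> product_order r \<and>
            inf \<bar>(case b' of (a, b) \<Rightarrow> snd a - snd b) - 0\<bar> w =
            inf \<bar>(case a' of (a, b) \<Rightarrow> x a - x b) - 0\<bar> w)"
      proof (intro bexI[of _ "(b1, b2)"] ballI impI)
        show "(b1, b2) \<in> B \<times> B" using b1 b2 by blast
        fix b' assume "b' \<in> B \<times> B" "((b1, b2), b') \<in> product_order s"
        then obtain c1 c2 where c: "b' = (c1, c2)" "c1 \<in> B" "c2 \<in> B" "(b1, c1) \<in> s" "(b2, c2) \<in> s"
          unfolding product_order_def by auto
        obtain d1 where d1: "d1 \<in> A" "(a1, d1) \<in> r" "snd c1 = x d1" using b1(2) c by blast
        obtain d2 where d2: "d2 \<in> A" "(a2, d2) \<in> r" "snd c2 = x d2" using b2(2) c by blast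
        show "\<exists>a'\<in>A \<times> A. (p, a') \<in> product_order r \<and>
            inf \<bar>(case b' of (a, b) \<Rightarrow> snd a - snd b) - 0\<bar> w =
            inf \<bar>(case a' of (a, b) \<Rightarrow> x a - x b) - 0\<bar> w"
          using p c d1 d2 unfolding product_order_def
          by (intro bexI[of _ "(d1, d2)"]) auto
      qed
    qed
  qed
  moreover have "\<not> o_convergent_to B s (\<lambda>b. i (snd b)) l" for l
  proof
    assume conv: "o_convergent_to B s (\<lambda>b. i (snd b)) l"
    have "o_convergent_to A r (\<lambda>a. i (x a)) l"
      by (rule o_convergent_to_transfer[OF conv]) (use of_B in metis)
    then show False using div by blast
  qed
  ultimately show ?thesis by blast
qed

end

theory Submission
  imports Defs
begin

text \<open>
  Let \<open>Z\<close> be the universal completion of \<open>X\<close>. Universal completeness is invariant under lattice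
  isomorphism, so \<open>X\<close> is a proper subspace of \<open>Z\<close>. This forces \<open>X\<close> to contain an infinite
  sequence of nonzero pairwise disjoint positive elements, and such a sequence carries the net.

  \<^bold>\<open>The sequence\<close> (\<open>disjoint_sequence\<close>). Let \<open>z \<ge> 0\<close> lie in \<open>Z\<close> but not in \<open>X\<close>. If some atom of
  \<open>Z\<close> that belongs to \<open>X\<close> lies below \<open>z\<close>, then the component of \<open>z\<close> along this atom is a multiple
  of the atom (\<open>atom_component\<close>), and removing it leaves a vector outside \<open>X\<close> and disjoint from
  the atom. If there is none, order density yields two nonzero disjoint vectors below \<open>z\<close>; a
  vector of \<open>X\<close> is taken below one of them, and the other one still has no atom of \<open>X\<close> below it.
  Either way a nonzero vector of \<open>X\<close> is split off from \<open>z\<close> and the procedure can be repeated on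
  the rest.

  \<^bold>\<open>The net\<close>. Given the sequence \<open>e\<close>, take \<open>(n, k) \<mapsto> k e\<^sub>n\<close>, where only the first index directs
  the net: \<open>(n, k)\<close> precedes \<open>(m, l)\<close> iff \<open>n \<le> m\<close>. Every tail contains all multiples of a nonzero
  vector, so no tail is order bounded in \<open>Z\<close>, and the net cannot be order convergent there.
  Nevertheless it is unbounded order null in \<open>X\<close>: for \<open>y \<ge> 0\<close> the vectors of \<open>X\<close> dominating some
  tail of \<open>k e\<^sub>n \<and> y\<close> form a downward directed set with infimum \<open>0\<close> (\<open>tail_bounds_inf\<close>). The
  point is that a positive lower bound of these vectors that is disjoint from almost all \<open>e\<^sub>n\<close>
  can be subtracted from a dominating vector again and again, and the Archimedean property makes
  it vanish (\<open>tail_bounds_lower_bound_zero\<close>).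
\<close>

section \<open>Disjointness and the Archimedean property\<close>

text \<open>Lattice-ordered groups are distributive, because \<open>a \<and> y = a + y - (a \<or> y)\<close>.\<close>
lemma inf_sup_le:
  fixes a b y v :: "'a::lattice_ab_group_add"
  assumes "inf a y \<le> v" "inf b y \<le> v"
  shows "inf (sup a b) y \<le> v"
proof -
  let ?s = "sup (sup a b) y"
  have "c \<le> v + ?s - y" if "inf c y \<le> v" "c \<le> sup a b" for c
  proof -
    have "c + y \<le> ?s + v"
      unfolding add_eq_inf_sup[of c y] using that by (intro add_mono sup_mono) auto
    then show ?thesis by (simp add: algebra_simps)
  qed
  then have "sup a b \<le> v + ?s - y" using assms by simp
  then have "sup a b + y \<le> v + ?s" by (simp only: le_diff_eq)
  then have "sup a b + y - ?s \<le> v" by (simp only: diff_le_eq)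
  moreover have "sup a b + y = ?s + inf (sup a b) y" by (rule add_eq_inf_sup)
  then have "inf (sup a b) y = sup a b + y - ?s" by (metis add_diff_cancel_left')
  ultimately show ?thesis by (simp only:)
qed

lemma disjoint_sum_le:
  fixes a b v :: "'a::lattice_ab_group_add"
  assumes "inf a b = 0" "a \<le> v" "b \<le> v"
  shows "a + b \<le> v"
  using assms by (simp add: add_eq_inf_sup[of a b])

lemma disjoint_sym:
  fixes a b :: "'a::lattice_ab_group_add"
  shows "inf a b = 0 \<Longrightarrow> inf b a = 0"
  by (subst inf_commute)

lemma disjoint_mono:
  fixes a b c d :: "'a::lattice_ab_group_add"
  assumes "inf a b = 0" "0 \<le> c" "c \<le> a" "0 \<le> d" "d \<le> b"
  shows "inf c d = 0"
proof (rule antisym)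
  show "inf c d \<le> 0" using inf_mono[OF assms(3,5)] assms(1) by simp
qed (use assms in simp)

lemma disjoint_scaleR:
  fixes a b :: "'a::vector_lattice"
  assumes "inf a b = 0" "0 \<le> s"
  shows "inf (s *\<^sub>R a) b = 0"
proof (rule antisym)
  have a: "0 \<le> a" and b: "0 \<le> b" using assms(1) by (metis inf_le1, metis inf_le2)
  define M where "M = max s 1"
  have M: "0 < M" "s \<le> M" "1 \<le> M" unfolding M_def by auto
  let ?t = "inf (s *\<^sub>R a) b"
  have "?t \<le> M *\<^sub>R a"
    using scaleR_right_mono[OF M(2) a] by (rule order_trans[OF inf_le1])
  moreover have "?t \<le> M *\<^sub>R b"
    using scaleR_right_mono[OF M(3) b] by (intro order_trans[OF inf_le2]) simp
  ultimately have "?t /\<^sub>R M \<le> a" "?t /\<^sub>R M \<le> b"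
    using M by (auto simp: pos_divideR_le_eq)
  then have "?t /\<^sub>R M \<le> 0" using assms(1) by (metis le_inf_iff)
  then show "?t \<le> 0" using M by (simp add: pos_divideR_le_eq)
  show "0 \<le> ?t" using a b assms(2) by (simp add: scaleR_nonneg_nonneg)
qed

lemma disjoint_pos_neg_parts:
  fixes w :: "'a::lattice_ab_group_add"
  shows "inf (sup w 0) (sup (- w) 0) = 0"
proof -
  have w: "w + sup (- w) 0 = sup w 0" by (simp add: add_sup_distrib_left sup_commute)
  have "inf w 0 + sup (- w) 0 = inf (w + sup (- w) 0) (0 + sup (- w) 0)"
    by (rule add_inf_distrib_right)
  then have "inf (sup w 0) (sup (- w) 0) = inf w 0 + sup (- w) 0"
    by (simp only: w add_0_left)
  moreover have "- inf w 0 = sup (- w) 0"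
    by (simp only: neg_inf_eq_sup minus_zero)
  then have "inf w 0 + sup (- w) 0 = 0" by (metis add.right_inverse)
  ultimately show ?thesis by (rule trans)
qed

lemma archimedean_le_zero:
  fixes x a :: "'a::archimedean_vector_lattice"
  assumes a: "0 \<le> a" and le: "\<And>n::nat. x \<le> (1 / real (Suc n)) *\<^sub>R a"
  shows "x \<le> 0"
proof -
  have "real n *\<^sub>R sup x 0 \<le> a" for n
  proof (cases n)
    case 0
    then show ?thesis using a by simp
  next
    case (Suc m)
    have "sup x 0 \<le> (1 / real (Suc m)) *\<^sub>R a"
      using le a by (simp add: scaleR_nonneg_nonneg)
    then have "sup x 0 \<le> a /\<^sub>R real n"
      using Suc by (simp add: inverse_eq_divide)
    then show ?thesis using Suc pos_le_divideR_eq[of "real n" "sup x 0" a] by simp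
  qed
  then have "sup x 0 = 0" using archimedean[of "sup x 0" a] by simp
  then show ?thesis by (metis sup_ge1)
qed

section \<open>Multiples of a disjoint sequence\<close>

definition tail_bounds :: "(nat \<Rightarrow> 'a::vector_lattice) \<Rightarrow> 'a \<Rightarrow> 'a set" where
  "tail_bounds e y = {v. \<exists>n. \<forall>m\<ge>n. \<forall>k::nat. inf (real k *\<^sub>R e m) y \<le> v}"

lemma tail_bounds_inf_closed:
  assumes "u \<in> tail_bounds e y" "v \<in> tail_bounds e y"
  shows "inf u v \<in> tail_bounds e y"
proof -
  obtain m n where "\<forall>j\<ge>m. \<forall>k::nat. inf (real k *\<^sub>R e j) y \<le> u"
    "\<forall>j\<ge>n. \<forall>k::nat. inf (real k *\<^sub>R e j) y \<le> v"
    using assms unfolding tail_bounds_def by blast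
  then show ?thesis
    unfolding tail_bounds_def by (auto intro!: exI[of _ "max m n"])
qed

lemma tail_bounds_nonneg:
  assumes "\<And>n. 0 \<le> e n" "0 \<le> y" "v \<in> tail_bounds e y"
  shows "0 \<le> v"
proof -
  obtain n where "\<And>k::nat. inf (real k *\<^sub>R e n) y \<le> v"
    using assms(3) unfolding tail_bounds_def by blast
  from this[of 0] show ?thesis using assms(2) by (simp add: inf_absorb1)
qed

text \<open>If \<open>v\<close> dominates a tail, then \<open>v\<close> dominates \<open>w\<close> and, on a further tail, vectors disjoint
  from \<open>w\<close>; hence it dominates the sums, and \<open>v - w\<close> dominates a tail too. Iterating this from
  \<open>y\<close> shows \<open>k w \<le> y\<close> for all \<open>k\<close>.\<close>
lemma tail_bounds_lower_bound_zero:
  fixes w :: "'a::archimedean_vector_lattice"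
  assumes e: "\<And>n. 0 \<le> e n" and y: "0 \<le> y"
    and w: "0 \<le> w" "\<And>v. v \<in> tail_bounds e y \<Longrightarrow> w \<le> v"
    and disj: "\<And>m. m \<ge> N \<Longrightarrow> inf (e m) w = 0"
  shows "w = 0"
proof -
  have step: "v - w \<in> tail_bounds e y" if v: "v \<in> tail_bounds e y" for v
  proof -
    obtain n where n: "\<And>m k. m \<ge> n \<Longrightarrow> inf (real k *\<^sub>R e m) y \<le> v"
      using v unfolding tail_bounds_def by blast
    have "inf (real k *\<^sub>R e m) y \<le> v - w" if m: "m \<ge> max n N" for m k
    proof -
      have "inf (real k *\<^sub>R e m) w = 0" using disj m by (intro disjoint_scaleR) auto
      then have "inf (inf (real k *\<^sub>R e m) y) w = 0"
        by (rule disjoint_mono) (use w e y in \<open>auto simp: scaleR_nonneg_nonneg\<close>)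
      then have "inf (real k *\<^sub>R e m) y + w \<le> v"
        using n m w(2)[OF v] by (intro disjoint_sum_le) auto
      then show ?thesis by (simp add: algebra_simps)
    qed
    then show ?thesis unfolding tail_bounds_def by blast
  qed
  have "y - real k *\<^sub>R w \<in> tail_bounds e y" for k
  proof (induction k)
    case 0
    show ?case unfolding tail_bounds_def by simp
  next
    case (Suc k)
    from step[OF this] show ?case by (simp add: algebra_simps)
  qed
  then have "0 \<le> y - real k *\<^sub>R w" for k
    by (rule tail_bounds_nonneg[OF e y])
  then have "real k *\<^sub>R w \<le> y" for k by simp
  then show ?thesis using archimedean[OF w(1)] by blast
qed

text \<open>A positive lower bound \<open>u\<close> is first shown to be disjoint from each \<open>e\<^sub>m\<close>, as \<open>u \<and> e\<^sub>m\<close> is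
  disjoint from all later members of the sequence; then \<open>u\<close> itself vanishes.\<close>
lemma tail_bounds_inf:
  fixes u :: "'a::archimedean_vector_lattice"
  assumes e: "\<And>n. 0 \<le> e n" and disj: "\<And>m n. m < n \<Longrightarrow> inf (e m) (e n) = 0" and y: "0 \<le> y"
    and u: "\<And>v. v \<in> tail_bounds e y \<Longrightarrow> u \<le> v"
  shows "u \<le> 0"
proof -
  let ?u = "sup u 0"
  have u': "?u \<le> v" if "v \<in> tail_bounds e y" for v
    using u tail_bounds_nonneg[OF e y] that by simp
  have u0: "0 \<le> ?u" by (rule sup_ge2)
  have "inf (e m) ?u = 0" for m
  proof (rule tail_bounds_lower_bound_zero[OF e y, where N = "Suc m"])
    show "inf (e j) (inf (e m) ?u) = 0" if "j \<ge> Suc m" for j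
    proof (rule disjoint_mono)
      show "inf (e j) (e m) = 0" using disj[of m j] that by (simp add: disjoint_sym)
      show "0 \<le> inf (e m) ?u" using e u0 by (rule inf_greatest)
    qed (use e in auto)
    show "0 \<le> inf (e m) ?u" using e u0 by (rule inf_greatest)
    show "inf (e m) ?u \<le> v" if "v \<in> tail_bounds e y" for v
      using u'[OF that] by (rule order_trans[OF inf_le2])
  qed
  then have "?u = 0"
    by (intro tail_bounds_lower_bound_zero[OF e y u0 u', where N = 0])
  then show ?thesis by (metis sup_ge1)
qed

lemma abs_diff_le_sup:
  fixes a b :: "'a::lattice_ab_group_add_abs"
  assumes "0 \<le> a" "0 \<le> b"
  shows "\<bar>a - b\<bar> \<le> sup a b"
proof (rule abs_leI)
  have "a - b \<le> a" "b - a \<le> b" using assms by (simp_all add: algebra_simps)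
  then show "a - b \<le> sup a b" "- (a - b) \<le> sup a b"
    by (auto intro: le_supI1 le_supI2)
qed

text \<open>As \<open>\<bar>a - b\<bar> \<le> a \<or> b\<close> for positive \<open>a\<close> and \<open>b\<close>, and the lattice is distributive, a vector that
  dominates the tail of \<open>k e\<^sub>n \<and> y\<close> also dominates the truncated differences.\<close>
lemma uo_Cauchy_multiples:
  fixes e :: "nat \<Rightarrow> 'a::archimedean_vector_lattice"
  assumes e: "\<And>n. 0 \<le> e n" and disj: "\<And>m n. m < n \<Longrightarrow> inf (e m) (e n) = 0"
  shows "uo_Cauchy UNIV {(p, q). fst p \<le> fst q} (\<lambda>(n, k::nat). real k *\<^sub>R e n)"
    (is "uo_Cauchy UNIV ?r ?x")
  unfolding uo_Cauchy_def uo_convergent_to_def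
proof (intro allI impI)
  fix y :: 'a assume y: "0 \<le> y"
  define G where "G = tail_bounds e y"
  define s where "s = {(u, v). u \<in> G \<and> v \<in> G \<and> v \<le> u}"
  have "y \<in> G" unfolding G_def tail_bounds_def by simp
  moreover have "preorder_on G s"
    unfolding preorder_on_def refl_on_def trans_def s_def by auto
  moreover have "\<exists>c\<in>G. (a, c) \<in> s \<and> (b, c) \<in> s" if "a \<in> G" "b \<in> G" for a b
    using that tail_bounds_inf_closed[of a e y b] unfolding G_def s_def
    by (intro bexI[of _ "inf a b"]) auto
  ultimately have dir: "directed_set G s" unfolding directed_set_def by blast
  have "isGlb UNIV G 0"
    unfolding isGlb_def greatestP_def isLb_def setle_def setge_def G_def
  proof (intro conjI ballI UNIV_I)
    show "0 \<le> v" if "v \<in> tail_bounds e y" for v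
      using that by (rule tail_bounds_nonneg[OF e y])
    show "u \<le> 0" if "u \<in> {u. (\<forall>v\<in>tail_bounds e y. u \<le> v) \<and> u \<in> UNIV}" for u
      by (rule tail_bounds_inf[OF e disj y]) (use that in auto)
  qed
  then have dec: "decreases_to_0 G s (\<lambda>v. v)"
    unfolding decreases_to_0_def s_def by auto
  show "o_convergent_to (UNIV \<times> UNIV) (product_order ?r)
      (\<lambda>p. inf \<bar>(case p of (a, b) \<Rightarrow> ?x a - ?x b) - 0\<bar> y) 0"
  proof (rule o_convergentI[OF dir dec], intro ballI)
    fix v assume "v \<in> G"
    then obtain n where n: "\<And>m k. m \<ge> n \<Longrightarrow> inf (real k *\<^sub>R e m) y \<le> v"
      unfolding G_def tail_bounds_def by blast
    have "\<bar>inf \<bar>?x a - ?x b\<bar> y\<bar> \<le> v" if ab: "n \<le> fst a" "n \<le> fst b" for a b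
    proof -
      have pos: "0 \<le> ?x c" for c using e by (simp add: split_beta scaleR_nonneg_nonneg)
      have "inf \<bar>?x a - ?x b\<bar> y \<le> inf (sup (?x a) (?x b)) y"
        using abs_diff_le_sup[OF pos pos] by (intro inf_mono) auto
      also have "\<dots> \<le> v"
        using n ab by (intro inf_sup_le) (simp_all add: split_beta)
      finally show ?thesis using y by (simp add: abs_of_nonneg)
    qed
    then show "\<exists>a\<in>UNIV \<times> UNIV. \<forall>b\<in>UNIV \<times> UNIV. (a, b) \<in> product_order ?r \<longrightarrow>
        \<bar>inf \<bar>(case b of (a, b) \<Rightarrow> ?x a - ?x b) - 0\<bar> y - 0\<bar> \<le> v"
      unfolding product_order_def
      by (intro bexI[of _ "((n, 0), (n, 0))"] ballI impI) (auto simp: split_beta)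
  qed
qed

text \<open>A tail of an order convergent net is order bounded, but every tail here contains all
  multiples of some \<open>f\<^sub>n \<noteq> 0\<close>.\<close>
lemma not_o_convergent_multiples:
  fixes f :: "nat \<Rightarrow> 'b::archimedean_vector_lattice"
  assumes f: "\<And>n. 0 \<le> f n" "\<And>n. f n \<noteq> 0"
  shows "\<not> o_convergent_to UNIV {(p, q). fst p \<le> fst q} (\<lambda>(n, k::nat). real k *\<^sub>R f n) l"
proof
  assume "o_convergent_to UNIV {(p, q). fst p \<le> fst q} (\<lambda>(n, k::nat). real k *\<^sub>R f n) l"
  then obtain G :: "'b set" and s z where G: "directed_set G s"
    and dom: "\<And>g. g \<in> G \<Longrightarrow> \<exists>n. \<forall>m\<ge>n. \<forall>k::nat.
      \<bar>real k *\<^sub>R f m - l\<bar> \<le> z g"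
    unfolding o_convergent_to_def by (force simp: Ball_def)
  obtain g where "g \<in> G" using G unfolding directed_set_def by blast
  then obtain n where n: "\<And>k::nat. \<bar>real k *\<^sub>R f n - l\<bar> \<le> z g" using dom by blast
  have "real k *\<^sub>R f n - l \<le> z g" for k using abs_ge_self n by (rule order_trans)
  then have "real k *\<^sub>R f n \<le> z g + l" for k by (simp add: diff_le_eq)
  then show False using archimedean[OF f(1)] f(2) by blast
qed

section \<open>Atoms and disjoint sequences\<close>

definition atom :: "'a::vector_lattice \<Rightarrow> bool" where
  "atom a \<longleftrightarrow> 0 \<le> a \<and> a \<noteq> 0 \<and>
     (\<forall>b c. 0 \<le> b \<and> b \<le> a \<and> 0 \<le> c \<and> c \<le> a \<and> inf b c = 0 \<longrightarrow> b = 0 \<or> c = 0)"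

text \<open>Let \<open>t\<close> be the largest scalar with \<open>t a \<le> z\<close>. For \<open>s > t\<close> the negative part of \<open>z - s a\<close> meets
  \<open>a\<close>, so the positive part, being disjoint from it, cannot meet the atom \<open>a\<close>. Letting \<open>s\<close> tend
  to \<open>t\<close> shows that \<open>z - t a\<close> is disjoint from \<open>a\<close>.\<close>
lemma atom_component:
  fixes a z :: "'a::archimedean_vector_lattice"
  assumes a: "atom a" and z: "0 \<le> z"
  obtains t where "0 \<le> t" "t *\<^sub>R a \<le> z" "inf (z - t *\<^sub>R a) a = 0"
proof -
  have a0: "0 \<le> a" "a \<noteq> 0" using a unfolding atom_def by auto
  define T where "T = {t. t *\<^sub>R a \<le> z}"
  obtain N :: nat where N: "\<not> real N *\<^sub>R a \<le> z" using archimedean[OF a0(1)] a0(2) by blast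
  have "t \<le> real N" if "t \<in> T" for t
  proof (rule ccontr)
    assume "\<not> t \<le> real N"
    then have "real N *\<^sub>R a \<le> t *\<^sub>R a" using a0 by (intro scaleR_right_mono) auto
    then show False using N that unfolding T_def by auto
  qed
  then have bdd: "bdd_above T" by (rule bdd_aboveI)
  have T0: "0 \<in> T" using z unfolding T_def by simp
  define t where "t = Sup T"
  have t0: "0 \<le> t" unfolding t_def using T0 bdd by (rule cSup_upper)
  have "t *\<^sub>R a - z \<le> 0"
  proof (rule archimedean_le_zero[OF a0(1)])
    fix n :: nat
    have "t - 1 / real (Suc n) < Sup T" unfolding t_def by simp
    then obtain s where s: "s \<in> T" "t - 1 / real (Suc n) < s"
      using T0 less_cSup_iff[OF _ bdd] by blast
    then have "(t - 1 / real (Suc n)) *\<^sub>R a \<le> s *\<^sub>R a"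
      using a0 by (intro scaleR_right_mono) auto
    also have "\<dots> \<le> z" using s unfolding T_def by simp
    finally show "t *\<^sub>R a - z \<le> (1 / real (Suc n)) *\<^sub>R a"
      by (simp add: scaleR_left_diff_distrib algebra_simps)
  qed
  then have tz: "t *\<^sub>R a \<le> z" by simp
  have "inf (z - t *\<^sub>R a) a \<le> 0"
  proof (rule archimedean_le_zero[OF a0(1)])
    fix n :: nat
    define d where "d = 1 / real (Suc n)"
    have d: "0 < d" unfolding d_def by simp
    define w where "w = z - (t + d) *\<^sub>R a"
    define b where "b = inf (sup w 0) a"
    define c where "c = inf (sup (- w) 0) a"
    have "inf b c = 0"
      using disjoint_pos_neg_parts[of w] unfolding b_def c_def
      by (rule disjoint_mono) (use a0 in auto)
    then have "b = 0 \<or> c = 0"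
      using a a0 unfolding atom_def b_def c_def by (metis inf_le2 le_inf_iff sup_ge2)
    moreover have "c \<noteq> 0"
    proof
      assume "c = 0"
      then have "inf ((t + d) *\<^sub>R a) (sup (- w) 0) = 0"
        using t0 d unfolding c_def by (intro disjoint_scaleR) (auto simp: inf_commute)
      moreover have "sup (- w) 0 \<le> (t + d) *\<^sub>R a"
        using z t0 d a0 unfolding w_def by (simp add: scaleR_nonneg_nonneg)
      ultimately have "sup (- w) 0 = 0" by (simp add: inf_absorb2)
      then have "0 \<le> w" by (metis neg_le_0_iff_le sup_ge1)
      then have "t + d \<in> T" unfolding T_def w_def by simp
      then have "t + d \<le> t" unfolding t_def using bdd by (rule cSup_upper)
      then show False using d by simp
    qed
    ultimately have b: "inf (sup w 0) a = 0" unfolding b_def by simp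
    let ?v = "inf (z - t *\<^sub>R a) a"
    have "?v - d *\<^sub>R a \<le> (z - t *\<^sub>R a) - d *\<^sub>R a" by (intro diff_mono) auto
    then have "?v - d *\<^sub>R a \<le> w"
      unfolding w_def by (simp add: scaleR_left_distrib algebra_simps)
    moreover have "?v - d *\<^sub>R a \<le> a - 0"
      using a0 d by (intro diff_mono) (auto simp: scaleR_nonneg_nonneg)
    ultimately have "?v - d *\<^sub>R a \<le> inf (sup w 0) a" by (auto intro: le_supI1)
    then show "?v \<le> (1 / real (Suc n)) *\<^sub>R a" unfolding b d_def by simp
  qed
  moreover have "0 \<le> inf (z - t *\<^sub>R a) a" using tz a0 by simp
  ultimately have "inf (z - t *\<^sub>R a) a = 0" by (rule antisym)
  then show thesis by (rule that[OF t0 tz])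
qed

text \<open>The invariant of the splitting procedure, with \<open>Y\<close> in the role of the subspace \<open>X\<close> of \<open>Z\<close>. Its
  two alternatives say why \<open>r\<close> is never used up: removing multiples of finitely many atoms of \<open>Y\<close>
  does not bring a vector outside \<open>Y\<close> into \<open>Y\<close>, and an atomless part can be halved forever.\<close>
definition splittable :: "'b::vector_lattice set \<Rightarrow> 'b \<Rightarrow> bool" where
  "splittable Y r \<longleftrightarrow> 0 \<le> r \<and> (r \<notin> Y \<or> r \<noteq> 0 \<and> (\<forall>a\<in>Y. a \<le> r \<longrightarrow> \<not> atom a))"

text \<open>If an atom \<open>a\<close> of \<open>Y\<close> lies below \<open>r\<close>, then \<open>e = a\<close> and \<open>r'\<close> is \<open>r\<close> without its component along
  \<open>a\<close>. Otherwise a vector of \<open>Y\<close> below \<open>r\<close> dominates two disjoint nonzero vectors \<open>b\<close> and \<open>c\<close>; then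
  \<open>e \<le> b\<close> comes from order density and \<open>r' = c\<close>.\<close>
lemma splittable_step:
  fixes r :: "'b::archimedean_vector_lattice"
  assumes Y: "subspace Y" "order_dense Y" and r: "splittable Y r"
  shows "\<exists>e r'. e \<in> Y \<and> 0 \<le> e \<and> e \<noteq> 0 \<and> e \<le> r \<and> r' \<le> r \<and> inf r' e = 0 \<and> splittable Y r'"
proof (cases "\<exists>a\<in>Y. a \<le> r \<and> atom a")
  case True
  then obtain a where a: "a \<in> Y" "a \<le> r" "atom a" by blast
  have r0: "0 \<le> r" "r \<notin> Y" using r a unfolding splittable_def by auto
  obtain t where t: "0 \<le> t" "t *\<^sub>R a \<le> r" "inf (r - t *\<^sub>R a) a = 0"
    using atom_component[OF a(3) r0(1)] .
  have a0: "0 \<le> a" "a \<noteq> 0" using a(3) unfolding atom_def by auto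
  have "r - t *\<^sub>R a \<notin> Y"
  proof
    assume "r - t *\<^sub>R a \<in> Y"
    then have "(r - t *\<^sub>R a) + t *\<^sub>R a \<in> Y"
      using Y(1) a(1) by (intro subspace_add subspace_scale)
    then show False using r0 by simp
  qed
  then have "splittable Y (r - t *\<^sub>R a)" using t unfolding splittable_def by simp
  moreover have "r - t *\<^sub>R a \<le> r" using t a0 by (simp add: scaleR_nonneg_nonneg)
  ultimately show ?thesis using a a0 t by blast
next
  case False
  have r0: "0 \<le> r" "r \<noteq> 0" using r subspace_0[OF Y(1)] unfolding splittable_def by auto
  obtain a where a: "a \<in> Y" "0 \<le> a" "a \<noteq> 0" "a \<le> r"
    using Y(2) r0 unfolding order_dense_def by blast
  then obtain b c where bc: "0 \<le> b" "b \<le> a" "0 \<le> c" "c \<le> a" "inf b c = 0" "b \<noteq> 0" "c \<noteq> 0"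
    using False unfolding atom_def by blast
  obtain e where e: "e \<in> Y" "0 \<le> e" "e \<noteq> 0" "e \<le> b"
    using Y(2) bc unfolding order_dense_def by blast
  have "c \<le> r" using bc(4) a(4) by (rule order_trans)
  then have "\<not> atom d" if "d \<in> Y" "d \<le> c" for d
    using False that order_trans by blast
  then have "splittable Y c" using bc(3,7) unfolding splittable_def by blast
  moreover have "inf c e = 0"
    by (rule disjoint_mono[OF disjoint_sym[OF bc(5)] bc(3) order_refl e(2,4)])
  moreover have "e \<le> r" by (rule order_trans[OF e(4) order_trans[OF bc(2) a(4)]])
  ultimately show ?thesis using e \<open>c \<le> r\<close> by blast
qed

text \<open>Each \<open>e\<^sub>n\<close> is split off from the remainder left by its predecessors. The remainders
  decrease and the one left after \<open>e\<^sub>n\<close> is disjoint from \<open>e\<^sub>n\<close>, so everything split off later is disjoint from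
  \<open>e\<^sub>n\<close> as well.\<close>
lemma disjoint_sequence:
  fixes Y :: "'b::archimedean_vector_lattice set"
  assumes Y: "subspace Y" "order_dense Y" and ne: "Y \<noteq> UNIV"
  obtains f :: "nat \<Rightarrow> 'b" where "\<And>n. f n \<in> Y" "\<And>n. 0 \<le> f n" "\<And>n. f n \<noteq> 0"
    "\<And>m n. m < n \<Longrightarrow> inf (f m) (f n) = 0"
proof -
  obtain z where z: "z \<notin> Y" using ne by blast
  obtain r0 where "splittable Y r0"
  proof -
    have "inf z 0 = - sup (- z) 0"
      using inf_eq_neg_sup[of z 0] by (simp only: minus_zero)
    then have "sup z 0 - sup (- z) 0 = z"
      using add_eq_inf_sup[of z 0] by (simp only: add_0_right diff_conv_add_uminus)
    then have "sup z 0 \<notin> Y \<or> sup (- z) 0 \<notin> Y" using z subspace_diff[OF Y(1)] by metis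
    then show thesis using that unfolding splittable_def by (meson sup_ge2)
  qed
  \<comment> \<open>A state is a pair of the vector split off last and the remainder after it.\<close>
  define P where "P = (\<lambda>(e, r). e \<in> Y \<and> 0 \<le> e \<and> e \<noteq> 0 \<and> inf r e = 0 \<and> splittable Y r)"
  define Q where "Q = (\<lambda>(e :: 'b, r :: 'b) (e', r'). e' \<le> r \<and> r' \<le> r)"
  have "\<exists>p. \<forall>n. P (p n) \<and> Q (p n) (p (Suc n))"
  proof (rule dependent_nat_choice)
    show "\<exists>p. P p"
      using splittable_step[OF Y \<open>splittable Y r0\<close>] unfolding P_def by auto
    show "\<exists>q. P q \<and> Q p q" if "P p" for p
      using splittable_step[OF Y, of "snd p"] that unfolding P_def Q_def by (auto simp: split_beta)
  qed
  then obtain p where p: "\<And>n. P (p n)" "\<And>n. Q (p n) (p (Suc n))" by blast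
  have dec: "snd (p n) \<le> snd (p m)" if "m \<le> n" for m n
    using that by (rule lift_Suc_antimono_le[rotated]) (use p in \<open>auto simp: Q_def split_beta\<close>)
  show thesis
  proof (rule that)
    fix m n :: nat assume "m < n"
    then obtain k where k: "n = Suc k" "m \<le> k" by (cases n) auto
    have "fst (p n) \<le> snd (p k)" using p(2)[of k] k unfolding Q_def by (simp add: split_beta)
    also have "\<dots> \<le> snd (p m)" using dec k by blast
    finally have le: "fst (p n) \<le> snd (p m)" .
    have "inf (snd (p m)) (fst (p m)) = 0" "0 \<le> fst (p m)" "0 \<le> fst (p n)"
      using p(1)[of m] p(1)[of n] unfolding P_def by (auto simp: split_beta)
    then show "inf (fst (p m)) (fst (p n)) = 0"
      using disjoint_mono[OF disjoint_sym _ order_refl _ le] by blast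
  qed (use p in \<open>auto simp: P_def split_beta\<close>)
qed

section \<open>Surjective lattice embeddings\<close>

lemma lattice_embedding_le_iff:
  assumes "lattice_embedding i"
  shows "i x \<le> i y \<longleftrightarrow> x \<le> y"
  using assms unfolding lattice_embedding_def inj_def by (metis le_iff_inf)

lemma universally_complete_transfer:
  fixes i :: "'a::vector_lattice \<Rightarrow> 'b::vector_lattice"
  assumes i: "lattice_embedding i" and surj: "surj i" and uc: "universally_complete TYPE('b)"
  shows "universally_complete TYPE('a)"
proof -
  note le = lattice_embedding_le_iff[OF i]
  have lub: "\<exists>s. isLub UNIV S s" if "isLub UNIV (i ` S) s'" for S s'
  proof -
    obtain s where "s' = i s" using surj by blast
    then have "isLub UNIV S s"
      using that le unfolding isLub_def leastP_def isUb_def setle_def setge_def by fastforce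
    then show ?thesis ..
  qed
  have glb: "\<exists>s. isGlb UNIV S s" if "isGlb UNIV (i ` S) s'" for S s'
  proof -
    obtain s where "s' = i s" using surj by blast
    then have "isGlb UNIV S s"
      using that le unfolding isGlb_def greatestP_def isLb_def setle_def setge_def by fastforce
    then show ?thesis ..
  qed
  have i0: "i 0 = 0" using i unfolding lattice_embedding_def by (simp add: linear_0)
  have complete: "(\<exists>s. isLub UNIV S s) \<and> (\<exists>t. isGlb UNIV S t)"
    if "S \<noteq> {}" "\<exists>l u. S \<subseteq> {l..u}" for S :: "'b set"
    using that uc[unfolded universally_complete_def dedekind_complete_def] by simp
  have complete_disjoint: "\<exists>s. isLub UNIV S s"
    if "S \<noteq> {}" "S \<subseteq> {0..}" "pairwise (\<lambda>x y. inf x y = 0) S" for S :: "'b set"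
    using that uc[unfolded universally_complete_def] by simp
  show ?thesis
    unfolding universally_complete_def dedekind_complete_def
  proof (intro conjI allI impI)
    fix S :: "'a set" assume S: "S \<noteq> {} \<and> (\<exists>l u. S \<subseteq> {l..u})"
    then obtain l u where "i ` S \<subseteq> {i l..i u}" using le by fastforce
    moreover have "i ` S \<noteq> {}" using S by simp
    ultimately have "(\<exists>s. isLub UNIV (i ` S) s) \<and> (\<exists>t. isGlb UNIV (i ` S) t)"
      by (intro complete) auto
    then show "\<exists>s. isLub UNIV S s" "\<exists>t. isGlb UNIV S t" using lub glb by blast+
  next
    fix S :: "'a set" assume S: "S \<noteq> {} \<and> S \<subseteq> {0..} \<and> pairwise (\<lambda>x y. inf x y = 0) S"
    have "i ` S \<subseteq> {0..}" using S le[of 0] i0 by auto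
    moreover have "pairwise (\<lambda>x y. inf x y = 0) (i ` S)"
      using S i i0 unfolding pairwise_def lattice_embedding_def by (metis imageE)
    ultimately have "\<exists>s. isLub UNIV (i ` S) s"
      using S by (intro complete_disjoint) auto
    then show "\<exists>s. isLub UNIV S s" using lub by blast
  qed
qed

theorem mainTheorem2:
  fixes i :: "'a::archimedean_vector_lattice \<Rightarrow> 'b::archimedean_vector_lattice"
  assumes "\<not> universally_complete TYPE('a)"
    and "is_universal_completion i"
  shows "\<exists>(A::('a set \<times> 'a) set) (r::('a set \<times> 'a) rel) (x::'a set \<times> 'a \<Rightarrow> 'a).
    directed_set A r \<and> uo_Cauchy A r x \<and>
    \<not> (\<exists>l::'b. o_convergent_to A r (\<lambda>a. i (x a)) l)"
proof -
  have i: "lattice_embedding i" and dense: "order_dense (range i)"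
    using assms(2) unfolding is_universal_completion_def by auto
  have lin: "linear i" and inj: "inj i" and inf: "\<And>x y. i (inf x y) = inf (i x) (i y)"
    using i unfolding lattice_embedding_def by auto
  note le = lattice_embedding_le_iff[OF i]
  have i0: "i 0 = 0" using lin by (rule linear_0)
  have ne: "range i \<noteq> UNIV"
    using universally_complete_transfer[OF i] assms
    unfolding is_universal_completion_def by blast
  have sub: "subspace (range i)" using lin by (simp add: linear_subspace_image)
  obtain f :: "nat \<Rightarrow> 'b" where f: "\<And>n. f n \<in> range i" "\<And>n. 0 \<le> f n" "\<And>n. f n \<noteq> 0"
    "\<And>m n. m < n \<Longrightarrow> inf (f m) (f n) = 0"
    by (rule disjoint_sequence[OF sub dense ne]) blast
  have "\<forall>n. \<exists>x. f n = i x" using f(1) by blast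
  then obtain e where e: "\<And>n. f n = i (e n)" by metis
  have e0: "0 \<le> e n" for n using f(2)[of n] le[of 0 "e n"] i0 e by simp
  have edisj: "inf (e m) (e n) = 0" if "m < n" for m n
    using f(4)[OF that] inf i0 inj e by (metis injD)
  let ?r = "{(p, q). fst p \<le> fst q} :: (nat \<times> nat) rel"
  let ?x = "\<lambda>(n, k::nat). real k *\<^sub>R e n"
  have "directed_set UNIV ?r"
    unfolding directed_set_def preorder_on_def refl_on_def trans_def
    by (auto intro: max.cobounded1 max.cobounded2)
  moreover have "uo_Cauchy UNIV ?r ?x" using e0 edisj by (rule uo_Cauchy_multiples)
  moreover have "(\<lambda>a. i (?x a)) = (\<lambda>(n, k::nat). real k *\<^sub>R f n)"
    using lin e by (auto simp: linear_scale)
  then have "\<nexists>l. o_convergent_to UNIV ?r (\<lambda>a. i (?x a)) l"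
    using not_o_convergent_multiples[of f] f by simp
  ultimately show ?thesis by (rule net_index_type)
qed

end
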